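(* Let $X=\mathbb{R}^n$, let $p>1$, $\frac1p+\frac1q=1$, and $\phi(x)=\frac{1}{p}\|x\|_p^p$. Let $T:X\rightrightarrows X^*$ be maximal monotone with $\operatorname{zer} T\neq\emptyset$, and assume that the following growth condition holds for some $\delta,\nu,\rho>0$: whenever $x \in T^{-1}(v)$ and $\|v\|_q<\delta$, one has $d_p(x,\operatorname{zer} T)\leq \rho\|v\|_q^\nu$. Let $\{x^k\}_{k=0}^\infty$, $\{v^k\}_{k=0}^\infty$ satisfy, for all $k\ge 0$, $v^k\in T(x^{k+1})$ and $x^{k+1}=x^k-\nabla\phi^*(v^k)$, and assume that $\{x^k\}_{k=0}^\infty$ has a limit point. Suppose $p>\frac{1}{\nu}+1$. Then the algorithm converges with order $\nu(p-1)$ and rate $\rho$, i.e., there exists $K$ such that for all $k\geq K$, $$d_p(x^{k+1},\operatorname{zer} T)\leq \rho\, \big(d_p(x^{k},\operatorname{zer} T)\big)^{\nu(p-1)}.$$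
   Context: $X^*=X=\mathbb{R}^n$ with the Euclidean inner product $\langle\cdot,\cdot\rangle$ as dual pairing; $\|\cdot\|_p$ and $\|\cdot\|_q$ are the $\ell^p$- and $\ell^q$-norms. The convex conjugate of $\phi$ is $\phi^*(v)=\frac1q\|v\|_q^q$. $\operatorname{zer} T=\{x\in X: 0\in T(x)\}$, $T^{-1}(v)=\{x\in X: v\in T(x)\}$, and $d_p(x,\operatorname{zer} T):=\inf_{y\in\operatorname{zer} T}\|x-y\|_p$. $T$ is monotone if $\langle x-y,x^*-y^*\rangle\ge0$ for all $(x,x^* ),(y,y^* )$ in its graph, and maximal monotone if its graph is not strictly contained in the graph of another monotone mapping. *)

theory Defs
  imports "HOL-Analysis.Analysis"
begin

definition lp_norm :: "real \<Rightarrow> real ^ 'n \<Rightarrow> real" where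
  "lp_norm p x = (\<Sum>i\<in>UNIV. \<bar>x $ i\<bar> powr p) powr (1 / p)"

definition phi :: "real \<Rightarrow> real ^ 'n \<Rightarrow> real" where
  "phi p x = (1 / p) * lp_norm p x powr p"

text \<open>
  The supremum is taken in the reals, so this is the convex conjugate only where the
  supremum is finite; for \<^term>\<open>phi p\<close> with \<^prop>\<open>p > 1\<close> it is finite everywhere
  (\<open>phi_conjugate_bdd_above\<close> below).
\<close>
definition convex_conjugate :: "('a::real_inner \<Rightarrow> real) \<Rightarrow> 'a \<Rightarrow> real" where
  "convex_conjugate f v = (SUP x. x \<bullet> v - f x)"

definition gradient :: "('a::real_inner \<Rightarrow> real) \<Rightarrow> 'a \<Rightarrow> 'a" where
  "gradient f v = (THE D. GDERIV f v :> D)"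

text \<open>
  A set-valued mapping from \<open>X\<close> to its dual \<open>X\<^sup>*\<close> is a function \<open>'a \<Rightarrow> 'a set\<close>;
  the dual is identified with the space itself through the inner product.
\<close>
definition op_graph :: "('a \<Rightarrow> 'a set) \<Rightarrow> ('a \<times> 'a) set" where
  "op_graph T = {(x, u). u \<in> T x}"

definition op_inverse :: "('a \<Rightarrow> 'a set) \<Rightarrow> 'a \<Rightarrow> 'a set" where
  "op_inverse T v = {x. v \<in> T x}"

definition zer :: "('a::zero \<Rightarrow> 'a set) \<Rightarrow> 'a set" where
  "zer T = {x. 0 \<in> T x}"

definition monotone_op :: "('a::real_inner \<Rightarrow> 'a set) \<Rightarrow> bool" where
  "monotone_op T \<longleftrightarrow>
     (\<forall>(x, u)\<in>op_graph T. \<forall>(y, w)\<in>op_graph T. (x - y) \<bullet> (u - w) \<ge> 0)"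

definition maximal_monotone :: "('a::real_inner \<Rightarrow> 'a set) \<Rightarrow> bool" where
  "maximal_monotone T \<longleftrightarrow>
     monotone_op T \<and> \<not> (\<exists>S. monotone_op S \<and> op_graph T \<subset> op_graph S)"

definition lp_dist :: "real \<Rightarrow> real ^ 'n \<Rightarrow> (real ^ 'n) set \<Rightarrow> real" where
  "lp_dist p x S = (INF y\<in>S. lp_norm p (x - y))"

lemma lp_norm_powr:
  assumes "p > 0"
  shows "lp_norm p x powr p = (\<Sum>i\<in>UNIV. \<bar>x $ i\<bar> powr p)"
  using assms by (simp add: lp_norm_def powr_powr sum_nonneg)

lemma conjugate_exponent_gt_1:
  fixes p q :: real
  assumes "p > 1" "1 / p + 1 / q = 1"
  shows "q > 1"
proof -
  have "0 < 1 / p" "1 / p < 1" using assms(1) by simp_all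
  then have "0 < 1 / q" "1 / q < 1" using assms(2) by linarith+
  then show ?thesis by (simp add: divide_less_eq_1)
qed

lemma phi_Young:
  fixes x v :: "real ^ 'n"
  assumes "p > 1" "1 / p + 1 / q = 1"
  shows "x \<bullet> v - phi p x \<le> phi q v"
proof -
  have q: "q > 1"
    by (rule conjugate_exponent_gt_1[OF assms])
  have Y: "x $ i * v $ i \<le> \<bar>x $ i\<bar> powr p / p + \<bar>v $ i\<bar> powr q / q" for i
  proof -
    have "x $ i * v $ i \<le> \<bar>x $ i\<bar> * \<bar>v $ i\<bar>"
      by (metis abs_ge_self abs_mult)
    also have "\<dots> \<le> \<bar>x $ i\<bar> powr p / p + \<bar>v $ i\<bar> powr q / q"
      using Youngs_inequality[of p q "\<bar>x $ i\<bar>" "\<bar>v $ i\<bar>"] assms q by simp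
    finally show ?thesis .
  qed
  have "x \<bullet> v \<le> (\<Sum>i\<in>UNIV. \<bar>x $ i\<bar> powr p / p + \<bar>v $ i\<bar> powr q / q)"
    unfolding inner_vec_def by (intro sum_mono) (simp add: Y)
  also have "\<dots> = phi p x + phi q v"
    using assms q by (simp add: phi_def lp_norm_powr sum.distrib sum_divide_distrib)
  finally show ?thesis by simp
qed

lemma phi_conjugate_bdd_above:
  fixes v :: "real ^ 'n"
  assumes "p > 1"
  shows "bdd_above (range (\<lambda>x. x \<bullet> v - phi p x))"
proof -
  have "1 / p + 1 / (p / (p - 1)) = 1"
    using assms by (simp add: field_simps)
  from phi_Young[OF assms this] show ?thesis
    by (intro bdd_aboveI2)
qed

lemma convex_conjugate_phi:
  fixes v :: "real ^ 'n"
  assumes "p > 1" "1 / p + 1 / q = 1"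
  shows "convex_conjugate (phi p) v = (1 / q) * lp_norm q v powr q"
proof -
  have q: "q > 1"
    by (rule conjugate_exponent_gt_1[OF assms])
  have pq: "(q - 1) * p = q"
    using assms q by (simp add: field_simps)
  define y :: "real ^ 'n" where "y = (\<chi> i. sgn (v $ i) * \<bar>v $ i\<bar> powr (q - 1))"
  have a: "\<bar>y $ i\<bar> powr p = \<bar>v $ i\<bar> powr q" for i
    using pq by (cases "v $ i = 0") (auto simp: y_def abs_mult abs_sgn_eq powr_powr)
  have b: "y $ i * v $ i = \<bar>v $ i\<bar> powr q" for i
  proof (cases "v $ i = 0")
    case False
    then have "\<bar>v $ i\<bar> powr q = \<bar>v $ i\<bar> powr (q - 1) * \<bar>v $ i\<bar>"
      by (simp add: powr_diff)
    then show ?thesis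
      by (simp add: y_def sgn_if)
  qed (simp add: y_def)
  have c: "1 / q = 1 - 1 / p" using assms by simp
  have "y \<bullet> v - phi p y = phi q v"
    using assms q c
    by (simp add: phi_def lp_norm_powr inner_vec_def a b) (simp add: field_simps)
  moreover have "(SUP x. x \<bullet> v - phi p x) = y \<bullet> v - phi p y"
    using phi_Young[OF assms, of _ v] calculation
    by (intro cSup_eq_maximum) (blast, auto)
  ultimately show ?thesis
    by (simp add: convex_conjugate_def phi_def)
qed

end

theory Submission
  imports Defs
begin

text \<open>
  Since \<open>v k\<close> is the gradient of \<open>phi p\<close> at the step \<open>d k = x k - x (k + 1)\<close>, testing monotonicity
  against a zero \<open>z\<close> and applying Young's inequality gives \<open>\<parallel>d k\<parallel>\<^sub>p \<le> \<parallel>x k - z\<parallel>\<^sub>p\<close>.  As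
  \<open>\<parallel>v k\<parallel>\<^sub>q\<close> is the power \<open>p - 1\<close> of \<open>\<parallel>d k\<parallel>\<^sub>p\<close>, the growth condition yields the
  estimate for every \<open>k\<close> with \<open>\<parallel>v k\<parallel>\<^sub>q < \<delta>\<close>, so it suffices that \<open>v k\<close> tends to \<open>0\<close>.

  Monotonicity between consecutive iterates makes \<open>\<parallel>d k\<parallel>\<^sub>p\<close> decreasing, and compactness together
  with the equality case of Young's inequality shows that \<open>d (k + 1) - d k\<close> tends to \<open>0\<close>.  If
  \<open>\<parallel>d k\<parallel>\<^sub>p\<close> had a positive limit, the iterates near a limit point would thus move arbitrarily
  far in an almost constant direction, against \<open>(x (k + M + 1) - z) \<bullet> v (k + M) \<ge> 0\<close>.
\<close>

section \<open>Comparison of \<open>phi\<close> with norms\<close>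

lemma phi_eq_sum:
  assumes "p > 0"
  shows "phi p x = (\<Sum>i\<in>UNIV. \<bar>x $ i\<bar> powr p) / p"
  using assms by (simp add: phi_def lp_norm_powr)

lemma phi_nonneg: "p > 0 \<Longrightarrow> phi p x \<ge> 0"
  by (simp add: phi_eq_sum sum_nonneg)

lemma phi_le_iff:
  assumes "p > 0"
  shows "phi p x \<le> phi p y \<longleftrightarrow> lp_norm p x \<le> lp_norm p y"
proof -
  have "lp_norm p x \<ge> 0" "lp_norm p y \<ge> 0"
    by (simp_all add: lp_norm_def)
  then show ?thesis
    using assms powr_mono2[of p "lp_norm p x" "lp_norm p y"]
      powr_less_mono2[of p "lp_norm p y" "lp_norm p x"]
    by (auto simp: phi_def divide_le_cancel not_le[symmetric])
qed

text \<open>Each coordinate is bounded by the \<open>p\<close>-th root of the full power sum, and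
  the Euclidean norm by the sum of the coordinates' absolute values. This crude bound makes sublevel
  sets of \<open>phi p\<close> bounded.\<close>

lemma norm_le_phi:
  fixes x :: "real ^ 'n"
  assumes "p > 0"
  shows "norm x \<le> CARD('n) * (p * phi p x) powr (1 / p)"
proof -
  have "\<bar>x $ i\<bar> \<le> (p * phi p x) powr (1 / p)" for i
  proof -
    have "\<bar>x $ i\<bar> powr p \<le> p * phi p x"
      using assms by (auto simp: phi_eq_sum intro!: member_le_sum)
    then have "(\<bar>x $ i\<bar> powr p) powr (1 / p) \<le> (p * phi p x) powr (1 / p)"
      using assms by (intro powr_mono2) auto
    then show ?thesis
      using assms by (simp add: powr_powr)
  qed
  then have "(\<Sum>i\<in>UNIV. \<bar>x $ i\<bar>) \<le> CARD('n) * (p * phi p x) powr (1 / p)"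
    by (intro sum_bounded_above) auto
  then show ?thesis
    using norm_le_l1_cart[of x] by linarith
qed

lemma bounded_phi_sublevel:
  fixes S :: "(real ^ 'n) set"
  assumes "p > 0" and "\<And>x. x \<in> S \<Longrightarrow> phi p x \<le> C"
  shows "bounded S"
proof (rule boundedI)
  fix x assume "x \<in> S"
  have "norm x \<le> CARD('n) * (p * phi p x) powr (1 / p)"
    by (rule norm_le_phi[OF assms(1)])
  also have "\<dots> \<le> CARD('n) * (p * C) powr (1 / p)"
    using assms \<open>x \<in> S\<close> by (intro mult_left_mono powr_mono2) (auto simp: phi_nonneg)
  finally show "norm x \<le> CARD('n) * (p * C) powr (1 / p)" .
qed

section \<open>Gradient of \<open>phi q\<close>\<close>

text \<open>For \<open>q > 1\<close> this is the gradient of \<open>phi q\<close>, so its value at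
  \<open>v k\<close> is the step of the algorithm.\<close>

definition duality_map :: "real \<Rightarrow> real ^ 'n \<Rightarrow> real ^ 'n" where
  "duality_map q v = (\<chi> i. sgn (v $ i) * \<bar>v $ i\<bar> powr (q - 1))"

text \<open>At 0 the difference quotient is \<open>sgn h * \<bar>h\<bar> powr (q - 1)\<close>, which
  vanishes in the limit because \<open>q > 1\<close>. Near \<open>t \<noteq> 0\<close> the absolute
  value is the linear map \<open>x \<mapsto> sgn t * x\<close>.\<close>

lemma has_real_derivative_abs_powr:
  fixes t q :: real
  assumes "q > 1"
  shows "((\<lambda>t. \<bar>t\<bar> powr q) has_real_derivative q * (sgn t * \<bar>t\<bar> powr (q - 1))) (at t)"
proof (cases "t = 0")
  case True
  have "((\<lambda>h. sgn h * \<bar>h\<bar> powr (q - 1)) \<longlongrightarrow> 0) (at (0::real))"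
  proof (rule Lim_null_comparison)
    show "\<forall>\<^sub>F h in at (0::real). norm (sgn h * \<bar>h\<bar> powr (q - 1)) \<le> \<bar>h\<bar> powr (q - 1)"
      by (intro always_eventually) (auto simp: abs_mult abs_sgn_eq)
    show "((\<lambda>h. \<bar>h\<bar> powr (q - 1)) \<longlongrightarrow> 0) (at (0::real))"
      using assms by (auto intro!: tendsto_eq_intros)
  qed
  moreover have "sgn h * \<bar>h\<bar> powr (q - 1) = \<bar>h\<bar> powr q / h" if "h \<noteq> 0" for h :: real
    using that by (simp add: powr_diff sgn_if)
  ultimately have "((\<lambda>h. \<bar>h\<bar> powr q / h) \<longlongrightarrow> 0) (at (0::real))"
    by (auto elim!: Lim_transform_eventually simp: eventually_at_filter)
  then show ?thesis
    using True by (simp add: DERIV_def)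
next
  case False
  have "((\<lambda>x. (sgn t * x) powr q) has_real_derivative q * (sgn t * \<bar>t\<bar> powr (q - 1))) (at t)"
    using False by (auto intro!: derivative_eq_intros simp: sgn_if)
  then show ?thesis
  proof (rule has_field_derivative_transform_within)
    show "\<bar>t\<bar> > 0" using False by simp
    show "(sgn t * x) powr q = \<bar>x\<bar> powr q" if "dist x t < \<bar>t\<bar>" for x
      using that by (auto simp: sgn_if dist_real_def abs_if split: if_splits)
  qed auto
qed

lemma GDERIV_phi:
  fixes v :: "real ^ 'n"
  assumes "q > 1"
  shows "GDERIV (phi q) v :> duality_map q v"
proof -
  have "((\<lambda>v. \<bar>v $ i\<bar> powr q) has_derivative
      (\<lambda>h. h $ i * (q * (sgn (v $ i) * \<bar>v $ i\<bar> powr (q - 1))))) (at v)" for i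
    using has_derivative_compose[OF bounded_linear_imp_has_derivative[OF bounded_linear_vec_nth[of i]]
        has_real_derivative_abs_powr[OF assms, of "v $ i", unfolded has_field_derivative_def]]
    by (simp add: mult.commute)
  then have "((\<lambda>v. (\<Sum>i\<in>UNIV. \<bar>v $ i\<bar> powr q) / q) has_derivative
      (\<lambda>h. (\<Sum>i\<in>UNIV. h $ i * (q * (sgn (v $ i) * \<bar>v $ i\<bar> powr (q - 1)))) / q)) (at v)"
    by (intro bounded_linear.has_derivative[OF bounded_linear_divide] has_derivative_sum)
  also have "(\<lambda>v. (\<Sum>i\<in>UNIV. \<bar>v $ i\<bar> powr q) / q) = phi q"
    using assms by (simp add: phi_eq_sum fun_eq_iff)
  also have "(\<lambda>h. (\<Sum>i\<in>UNIV. h $ i * (q * (sgn (v $ i) * \<bar>v $ i\<bar> powr (q - 1)))) / q)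
      = (\<lambda>h. h \<bullet> duality_map q v)"
    using assms by (auto simp: inner_vec_def duality_map_def sum_divide_distrib)
  finally show ?thesis by (simp add: gderiv_def)
qed

lemma gradient_eqI:
  assumes "GDERIV f v :> D"
  shows "gradient f v = D"
  unfolding gradient_def
proof (rule the_equality)
  fix E assume "GDERIV f v :> E"
  then have "(\<lambda>h. h \<bullet> E) = (\<lambda>h. h \<bullet> D)"
    using assms has_derivative_unique unfolding gderiv_def by blast
  then show "E = D"
    by (metis vector_eq_ldot)
qed fact

lemma continuous_phi: "q > 1 \<Longrightarrow> isCont (phi q) v"
  using GDERIV_phi has_derivative_continuous unfolding gderiv_def by blast

text \<open>The factor \<open>sgn\<close> jumps at 0, so each coordinate is rewritten as a
  difference of powers of its positive and negative parts, both continuous since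
  \<open>q - 1 > 0\<close>.\<close>

lemma continuous_duality_map:
  fixes v :: "real ^ 'n"
  assumes "q > 1"
  shows "isCont (duality_map q) v"
proof -
  have "sgn t * \<bar>t\<bar> powr (q - 1) = (max t 0) powr (q - 1) - (max (- t) 0) powr (q - 1)" for t
    using assms by (auto simp: sgn_if)
  then have "duality_map q =
      (\<lambda>v :: real ^ 'n. \<chi> i. (max (v $ i) 0) powr (q - 1) - (max (- v $ i) 0) powr (q - 1))"
    by (simp add: duality_map_def fun_eq_iff)
  moreover have "continuous_on UNIV \<dots>"
    using assms by (intro continuous_intros continuous_on_powr') auto
  ultimately show ?thesis
    by (simp add: continuous_on_eq_continuous_at)
qed

section \<open>Equality in the Fenchel-Young inequality\<close>

lemma inner_duality_map:
  fixes v :: "real ^ 'n"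
  assumes "q > 0"
  shows "duality_map q v \<bullet> v = q * phi q v"
proof -
  have "sgn t * \<bar>t\<bar> powr (q - 1) * t = \<bar>t\<bar> powr q" for t
    by (cases "t = 0") (auto simp: powr_diff sgn_if)
  then show ?thesis
    using assms by (simp add: phi_eq_sum inner_vec_def duality_map_def)
qed

lemma lp_norm_duality_map:
  fixes v :: "real ^ 'n"
  assumes "p > 1" "1 / p + 1 / q = 1"
  shows "lp_norm p (duality_map q v) powr p = lp_norm q v powr q"
proof -
  have q: "q > 1"
    by (rule conjugate_exponent_gt_1[OF assms])
  have "(q - 1) * p = q"
    using assms q by (simp add: field_simps)
  then have "\<bar>sgn t * \<bar>t\<bar> powr (q - 1)\<bar> powr p = \<bar>t\<bar> powr q" for t
    by (cases "t = 0") (auto simp: abs_mult abs_sgn_eq powr_powr)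
  then show ?thesis
    using assms q by (simp add: lp_norm_powr duality_map_def)
qed

text \<open>Everything is a multiple of \<open>phi q v\<close>: the left side with factor
  \<open>q\<close>, the right side with factor \<open>q / p + 1\<close>, and these agree for
  conjugate exponents.\<close>

lemma Fenchel_equality_duality_map:
  fixes v :: "real ^ 'n"
  assumes "p > 1" "1 / p + 1 / q = 1"
  shows "duality_map q v \<bullet> v = phi p (duality_map q v) + phi q v"
proof -
  have q: "q > 1"
    by (rule conjugate_exponent_gt_1[OF assms])
  have "phi p (duality_map q v) = q * phi q v / p"
    using assms q by (simp add: phi_def lp_norm_duality_map)
  moreover have "q * phi q v = q * phi q v * (1 / p + 1 / q)"
    by (simp only: assms(2) mult_1_right)
  then have "q * phi q v = q * phi q v / p + phi q v"
    using q by (simp add: distrib_left)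
  ultimately show ?thesis
    using q by (simp add: inner_duality_map)
qed

text \<open>
  Equality in the Fenchel--Young inequality says that \<open>v\<close> maximises \<open>w \<mapsto> a \<bullet> w - phi q w\<close>,
  so the gradient of this function vanishes at \<open>v\<close>.
\<close>
lemma Fenchel_equality_imp_duality_map:
  fixes a v :: "real ^ 'n"
  assumes "p > 1" "1 / p + 1 / q = 1" and "phi p a + phi q v \<le> a \<bullet> v"
  shows "a = duality_map q v"
proof -
  have q: "q > 1"
    by (rule conjugate_exponent_gt_1[OF assms(1,2)])
  have "((\<lambda>w. a \<bullet> w - phi q w) has_derivative (\<lambda>h. a \<bullet> h - h \<bullet> duality_map q v)) (at v)"
    using GDERIV_phi[OF q, of v] unfolding gderiv_def by (auto intro!: derivative_eq_intros)
  moreover have "a \<bullet> w - phi q w \<le> a \<bullet> v - phi q v" for w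
    using phi_Young[OF assms(1,2), of a w] assms(3) by simp
  ultimately have "(\<lambda>h. a \<bullet> h - h \<bullet> duality_map q v) = (\<lambda>h. 0)"
    using differential_zero_maxmin[of v UNIV] by auto
  then have "h \<bullet> a = h \<bullet> duality_map q v" for h
    by (auto simp: fun_eq_iff inner_commute)
  then show ?thesis
    by (metis vector_eq_ldot)
qed

section \<open>Decay of the dual vectors\<close>

text \<open>
  Since \<open>duality_map q (v k)\<close> is the step \<open>x k - x (k + 1)\<close>, the hypothesis is the monotonicity
  of \<open>T\<close> between the points \<open>x (k + 1)\<close> and \<open>x (k + 2)\<close>.
\<close>
lemma phi_steps_decseq:
  fixes v :: "nat \<Rightarrow> real ^ 'n"
  assumes "p > 1" "1 / p + 1 / q = 1"
    and "\<And>k. duality_map q (v (Suc k)) \<bullet> v (Suc k) \<le> duality_map q (v (Suc k)) \<bullet> v k"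
  shows "decseq (\<lambda>k. phi q (v k))"
proof (rule decseq_SucI)
  fix k
  show "phi q (v (Suc k)) \<le> phi q (v k)"
    using assms(3)[of k] phi_Young[OF assms(1,2), of "duality_map q (v (Suc k))" "v k"]
    by (simp add: Fenchel_equality_duality_map[OF assms(1,2)])
qed

text \<open>Otherwise consecutive steps stay at distance \<open>e\<close> along a subsequence, on
  which by compactness \<open>v (Suc k)\<close> and \<open>v k\<close> converge to some
  \<open>u\<close> and \<open>w\<close>. The decreasing values \<open>phi q (v k)\<close> converge,
  so \<open>phi q u = phi q w\<close>.\<close>

lemma steps_difference_tendsto_0:
  fixes v :: "nat \<Rightarrow> real ^ 'n"
  assumes pq: "p > 1" "1 / p + 1 / q = 1"
    and mono: "\<And>k. duality_map q (v (Suc k)) \<bullet> v (Suc k) \<le> duality_map q (v (Suc k)) \<bullet> v k"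
  shows "(\<lambda>k. duality_map q (v (Suc k)) - duality_map q (v k)) \<longlonglongrightarrow> 0"
proof (rule ccontr)
  assume neg: "\<not> ?thesis"
  have q: "q > 1"
    by (rule conjugate_exponent_gt_1[OF pq])
  define J where "J = (duality_map q :: real ^ 'n \<Rightarrow> real ^ 'n)"
  obtain e where e: "e > 0" and inf: "\<forall>N. \<exists>k\<ge>N. norm (J (v (Suc k)) - J (v k)) \<ge> e"
    using neg by (force simp: LIMSEQ_iff J_def not_less)
  then have "\<exists>\<^sub>\<infinity>k. norm (J (v (Suc k)) - J (v k)) \<ge> e"
    by (simp add: INFM_nat_le)
  then obtain s :: "nat \<Rightarrow> nat" where s: "strict_mono s"
    and sep: "\<And>j. norm (J (v (Suc (s j))) - J (v (s j))) \<ge> e"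
    using infinite_enumerate[of "{k. norm (J (v (Suc k)) - J (v k)) \<ge> e}"]
    by (auto simp: INFM_iff_infinite)
  have dec: "decseq (\<lambda>k. phi q (v k))"
    by (rule phi_steps_decseq[of p q v, OF pq mono])
  have bdd: "bounded (range v)"
    using q decseqD[OF dec, of 0] by (intro bounded_phi_sublevel[of q _ "phi q (v 0)"]) auto
  have "bounded (range (\<lambda>j. (v (Suc (s j)), v (s j))))"
    by (rule bounded_subset[OF bounded_Times[OF bdd bdd]]) auto
  then obtain l t where t: "strict_mono (t :: nat \<Rightarrow> nat)"
    and lim: "((\<lambda>j. (v (Suc (s j)), v (s j))) \<circ> t) \<longlonglongrightarrow> l"
    using bounded_imp_convergent_subsequence by blast
  obtain u w where l: "l = (u, w)" by fastforce
  have u: "(\<lambda>j. v (Suc (s (t j)))) \<longlonglongrightarrow> u" and w: "(\<lambda>j. v (s (t j))) \<longlonglongrightarrow> w"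
    using tendsto_fst[OF lim] tendsto_snd[OF lim] by (simp_all add: l o_def)
  have Ju: "(\<lambda>j. J (v (Suc (s (t j))))) \<longlonglongrightarrow> J u" and Jw: "(\<lambda>j. J (v (s (t j)))) \<longlonglongrightarrow> J w"
    using u w isCont_tendsto_compose[OF continuous_duality_map[OF q]] by (auto simp: J_def)
  have nonneg: "0 \<le> phi q (v k)" for k
    using q by (simp add: phi_nonneg)
  obtain D where D: "(\<lambda>k. phi q (v k)) \<longlonglongrightarrow> D"
    using decseq_convergent[OF dec, of 0] nonneg by blast
  have st: "strict_mono (\<lambda>j. s (t j))" "strict_mono (\<lambda>j. Suc (s (t j)))"
    using s t by (auto simp: strict_mono_def)
  have "phi q u = D" "phi q w = D"
    using LIMSEQ_unique[OF isCont_tendsto_compose[OF continuous_phi[OF q] u]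
        LIMSEQ_subseq_LIMSEQ[OF D st(2), unfolded o_def]]
      LIMSEQ_unique[OF isCont_tendsto_compose[OF continuous_phi[OF q] w]
        LIMSEQ_subseq_LIMSEQ[OF D st(1), unfolded o_def]]
    by auto
  \<comment> \<open>As \<open>phi q u = phi q w\<close>, this limit of \<open>mono\<close> turns the
    Fenchel equality at \<open>u\<close> into equality for the pair \<open>J u\<close>,
    \<open>w\<close>, whence \<open>J u = J w\<close> against the separation by
    \<open>e\<close>.\<close>
  moreover have "J u \<bullet> u \<le> J u \<bullet> w"
    using mono by (intro LIMSEQ_le[OF tendsto_inner[OF Ju u] tendsto_inner[OF Ju w]])
      (auto simp: J_def)
  ultimately have "J u = J w"
    using Fenchel_equality_duality_map[OF pq, of u]
      Fenchel_equality_imp_duality_map[OF pq, of "J u" w] by (simp add: J_def)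
  then have "(\<lambda>j. norm (J (v (Suc (s (t j)))) - J (v (s (t j))))) \<longlonglongrightarrow> 0"
    using tendsto_norm[OF tendsto_diff[OF Ju Jw]] by simp
  then have "e \<le> 0"
    using sep by (intro LIMSEQ_le_const) auto
  then show False
    using e by simp
qed

text \<open>From the bounded iterates \<open>x (r j)\<close>, follow \<open>M + 1\<close> nearly
  equal steps and test \<open>zero\<close> at the end. This bounds \<open>M * (q * D)\<close>
  independently of \<open>M\<close>, so the limit \<open>D\<close> of \<open>phi q (v k)\<close>
  vanishes.\<close>

lemma iterates_dual_tendsto_0:
  fixes x v :: "nat \<Rightarrow> real ^ 'n" and r :: "nat \<Rightarrow> nat"
  assumes pq: "p > 1" "1 / p + 1 / q = 1"
    and step: "\<And>k. x (Suc k) = x k - duality_map q (v k)"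
    and mono: "\<And>k. (x (Suc (Suc k)) - x (Suc k)) \<bullet> (v (Suc k) - v k) \<ge> 0"
    and zero: "\<And>k. (x (Suc k) - z) \<bullet> v k \<ge> 0"
    and r: "strict_mono r" "bounded (range (x \<circ> r))"
  shows "(\<lambda>k. phi q (v k)) \<longlonglongrightarrow> 0"
proof -
  have q: "q > 1"
    by (rule conjugate_exponent_gt_1[OF pq])
  define d where "d k = duality_map q (v k)" for k
  have mono': "duality_map q (v (Suc k)) \<bullet> v (Suc k) \<le> duality_map q (v (Suc k)) \<bullet> v k" for k
    using mono[of k] by (simp add: step inner_diff_right)
  have dec: "decseq (\<lambda>k. phi q (v k))"
    by (rule phi_steps_decseq[of p q v, OF pq mono'])
  have nonneg: "0 \<le> phi q (v k)" for k
    using q by (simp add: phi_nonneg)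
  obtain D where D: "(\<lambda>k. phi q (v k)) \<longlonglongrightarrow> D" and le: "\<And>k. D \<le> phi q (v k)"
    using decseq_convergent[OF dec, of 0] nonneg by blast
  have D0: "D \<ge> 0"
    using D nonneg by (intro LIMSEQ_le_const) auto
  have "bounded (range v)"
    using q decseqD[OF dec, of 0] by (intro bounded_phi_sublevel[of q _ "phi q (v 0)"]) auto
  then obtain V where V: "\<And>k. norm (v k) \<le> V"
    by (auto simp: bounded_iff)
  obtain B where B: "\<And>j. norm (x (r j)) \<le> B"
    using r(2) by (auto simp: bounded_iff)
  have iterate: "x (k + m) = x k - (\<Sum>i<m. d (k + i))" for k m
    by (induction m) (auto simp: step d_def)
  have shift: "(\<lambda>k. d (k + m) - d k) \<longlonglongrightarrow> 0" for m
  proof (induction m)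
    case (Suc m)
    have "(\<lambda>k. d (Suc k) - d k) \<longlonglongrightarrow> 0"
      unfolding d_def by (rule steps_difference_tendsto_0[of p q v, OF pq mono'])
    then have "(\<lambda>k. d (Suc (k + m)) - d (k + m)) \<longlonglongrightarrow> 0"
      by (rule LIMSEQ_ignore_initial_segment)
    from tendsto_add[OF this Suc] show ?case by simp
  qed simp
  have "real M * (q * D) \<le> (B + norm z) * V" for M
  proof -
    \<comment> \<open>The error of replacing all \<open>M + 1\<close> steps by the last one, which
      is chosen because its inner product with \<open>v (k + M)\<close> is exactly
      \<open>q * phi q (v (k + M))\<close>.\<close>
    define s where "s k = (\<Sum>i<Suc M. d (k + i) - d (k + M))" for k
    have "(\<lambda>k. d (k + i) - d (k + M)) \<longlonglongrightarrow> 0" for i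
      using tendsto_diff[OF shift[of i] shift[of M]] by simp
    then have "s \<longlonglongrightarrow> 0"
      unfolding s_def by (intro tendsto_null_sum)
    then have "(\<lambda>j. norm (s (r j))) \<longlonglongrightarrow> 0"
      using LIMSEQ_subseq_LIMSEQ[OF _ r(1)] by (auto simp: o_def intro: tendsto_norm_zero)
    then have "(\<lambda>j. (B + norm z) * V + norm (s (r j)) * V) \<longlonglongrightarrow> (B + norm z) * V + 0 * V"
      by (intro tendsto_intros)
    moreover have "real M * (q * D) \<le> (B + norm z) * V + norm (s (r j)) * V" for j
    proof -
      define k where "k = r j"
      have "x (Suc (k + M)) - z = (x k - z) - s k - real (Suc M) *\<^sub>R d (k + M)"
        using iterate[of k "Suc M"] unfolding s_def sum_subtractf sum_constant_scaleR
        by (simp add: algebra_simps)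
      then have "0 \<le> (x k - z - s k - real (Suc M) *\<^sub>R d (k + M)) \<bullet> v (k + M)"
        using zero[of "k + M"] by (simp only:)
      then have "0 \<le> (x k - z) \<bullet> v (k + M) - s k \<bullet> v (k + M)
          - real (Suc M) * (q * phi q (v (k + M)))"
        using q inner_duality_map[of q "v (k + M)"] by (simp add: inner_diff_left d_def)
      moreover have "real M * (q * D) \<le> real (Suc M) * (q * phi q (v (k + M)))"
        using q D0 le by (intro mult_mono) auto
      moreover have "(x k - z) \<bullet> v (k + M) \<le> (B + norm z) * V"
      proof -
        have "(x k - z) \<bullet> v (k + M) \<le> norm (x k - z) * norm (v (k + M))"
          by (rule norm_cauchy_schwarz)
        also have "\<dots> \<le> (B + norm z) * V"
        proof (rule mult_mono')
          show "norm (x k - z) \<le> B + norm z"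
            using B[of j] norm_triangle_ineq4[of "x k" z] by (simp add: k_def)
        qed (use V in auto)
        finally show ?thesis .
      qed
      moreover have "- (s k \<bullet> v (k + M)) \<le> norm (s k) * V"
        using Cauchy_Schwarz_ineq2[of "s k" "v (k + M)"]
          mult_left_mono[OF V norm_ge_zero, of "s k" "k + M"]
        by linarith
      ultimately show ?thesis
        unfolding k_def by linarith
    qed
    ultimately show ?thesis
      by (intro LIMSEQ_le_const) auto
  qed
  then have "\<not> q * D > 0"
    using reals_Archimedean3[of "q * D"] by (meson linorder_not_less)
  with D0 q have "D = 0"
    by (simp add: zero_less_mult_iff)
  with D show ?thesis by simp
qed

section \<open>Order estimate\<close>

text \<open>Conjugacy gives \<open>p - 1 = p / q\<close>; this is where the factor
  \<open>p - 1\<close> of the order comes from.\<close>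

lemma lp_norm_dual_step:
  fixes v :: "real ^ 'n"
  assumes "p > 1" "1 / p + 1 / q = 1"
  shows "lp_norm q v = lp_norm p (duality_map q v) powr (p - 1)"
proof -
  have q: "q > 1"
    by (rule conjugate_exponent_gt_1[OF assms])
  have e: "p - 1 = p * (1 / q)"
    using assms q by (simp add: field_simps)
  have "lp_norm p (duality_map q v) powr (p - 1) = (lp_norm q v powr q) powr (1 / q)"
    unfolding e powr_powr[symmetric] lp_norm_duality_map[OF assms] ..
  then show ?thesis
    using q by (simp add: powr_powr lp_norm_def sum_nonneg)
qed

text \<open>Young's inequality bounds \<open>(x - z) \<bullet> v\<close> above, and the Fenchel
  equality evaluates the smaller \<open>duality_map q v \<bullet> v\<close>. The common term
  \<open>phi q v\<close> cancels, leaving a comparison of \<open>phi p\<close> for each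
  \<open>z\<close>.\<close>

lemma lp_norm_step_le_lp_dist:
  fixes x v :: "real ^ 'n"
  assumes pq: "p > 1" "1 / p + 1 / q = 1" and "S \<noteq> {}"
    and "\<And>z. z \<in> S \<Longrightarrow> (x - duality_map q v - z) \<bullet> v \<ge> 0"
  shows "lp_norm p (duality_map q v) \<le> lp_dist p x S"
  unfolding lp_dist_def
proof (rule cINF_greatest[OF assms(3)])
  fix z assume "z \<in> S"
  have "phi p (duality_map q v) \<le> phi p (x - z)"
    using assms(4)[OF \<open>z \<in> S\<close>] phi_Young[OF pq, of "x - z" v]
      Fenchel_equality_duality_map[OF pq, of v]
    by (simp add: inner_diff_left)
  then show "lp_norm p (duality_map q v) \<le> lp_norm p (x - z)"
    using pq by (simp add: phi_le_iff)
qed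

theorem proposition4p24:
  fixes T :: "real ^ 'n \<Rightarrow> (real ^ 'n) set"
    and x v :: "nat \<Rightarrow> real ^ 'n"
    and p q \<delta> \<nu> \<rho> :: real
  assumes "p > 1" and "1 / p + 1 / q = 1"
    and "maximal_monotone T" and "zer T \<noteq> {}"
    and "\<delta> > 0" and "\<nu> > 0" and "\<rho> > 0"
    and growth: "\<And>y u. y \<in> op_inverse T u \<Longrightarrow> lp_norm q u < \<delta> \<Longrightarrow>
                   lp_dist p y (zer T) \<le> \<rho> * lp_norm q u powr \<nu>"
    and "\<And>k. v k \<in> T (x (Suc k))"
    and "\<And>k. x (Suc k) = x k - gradient (convex_conjugate (phi p)) (v k)"
    and limit_point: "\<exists>l r. strict_mono r \<and> (x \<circ> r) \<longlonglongrightarrow> l"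
    and "p > 1 / \<nu> + 1"
  shows "\<exists>K. \<forall>k\<ge>K. lp_dist p (x (Suc k)) (zer T)
                    \<le> \<rho> * lp_dist p (x k) (zer T) powr (\<nu> * (p - 1))"
proof -
  note pq = assms(1,2)
  have q: "q > 1"
    by (rule conjugate_exponent_gt_1[OF pq])
  have "convex_conjugate (phi p) = (phi q :: real ^ 'n \<Rightarrow> real)"
    by (simp add: fun_eq_iff convex_conjugate_phi[OF pq] phi_def)
  then have step: "x (Suc k) = x k - duality_map q (v k)" for k
    using assms(10) gradient_eqI[OF GDERIV_phi[OF q]] by simp
  have mono: "(a - b) \<bullet> (u - w) \<ge> 0" if "u \<in> T a" "w \<in> T b" for a b u w
    using assms(3) that by (fastforce simp: maximal_monotone_def monotone_op_def op_graph_def)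
  have zero: "(x (Suc k) - z) \<bullet> v k \<ge> 0" if "z \<in> zer T" for k z
    using mono[of "v k" "x (Suc k)" 0 z] assms(9) that by (simp add: zer_def)
  obtain l r where r: "strict_mono r" and l: "(x \<circ> r) \<longlonglongrightarrow> l"
    using limit_point by blast
  obtain z where "z \<in> zer T"
    using assms(4) by blast
  then have "(\<lambda>k. phi q (v k)) \<longlonglongrightarrow> 0"
    by (intro iterates_dual_tendsto_0[OF pq step mono[OF assms(9,9)] zero r
        convergent_imp_bounded[OF l]])
  \<comment> \<open>The threshold is the value of \<open>phi q\<close> at vectors of
    \<open>q\<close>-norm \<open>\<delta>\<close>, so falling below it makes the growth condition
    applicable.\<close>
  moreover have "\<delta> powr q / q > 0"
    using \<open>\<delta> > 0\<close> q by simp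
  ultimately have "\<forall>\<^sub>F k in sequentially. phi q (v k) < \<delta> powr q / q"
    by (rule order_tendstoD(2))
  then obtain K where K: "\<And>k. k \<ge> K \<Longrightarrow> phi q (v k) < \<delta> powr q / q"
    by (auto simp: eventually_sequentially)
  have "lp_dist p (x (Suc k)) (zer T) \<le> \<rho> * lp_dist p (x k) (zer T) powr (\<nu> * (p - 1))"
    if "k \<ge> K" for k
  proof -
    let ?d = "lp_norm p (duality_map q (v k))"
    have "lp_norm q (v k) powr q < \<delta> powr q"
      using K[OF that] q by (simp add: phi_def divide_less_cancel)
    then have "lp_norm q (v k) < \<delta>"
      using powr_mono2[of q \<delta> "lp_norm q (v k)"] q \<open>\<delta> > 0\<close> by fastforce
    then have "lp_dist p (x (Suc k)) (zer T) \<le> \<rho> * lp_norm q (v k) powr \<nu>"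
      using assms(9) by (intro growth) (auto simp: op_inverse_def)
    also have "lp_norm q (v k) powr \<nu> = ?d powr (\<nu> * (p - 1))"
      by (subst lp_norm_dual_step[OF pq]) (simp add: powr_powr mult.commute)
    also have "\<rho> * \<dots> \<le> \<rho> * lp_dist p (x k) (zer T) powr (\<nu> * (p - 1))"
    proof (intro mult_left_mono powr_mono2)
      show "?d \<le> lp_dist p (x k) (zer T)"
        using zero[of _ k] assms(4) by (intro lp_norm_step_le_lp_dist[OF pq]) (auto simp: step)
      show "0 \<le> ?d"
        by (simp add: lp_norm_def)
    qed (use assms(1,6,7) in auto)
    finally show ?thesis .
  qed
  then show ?thesis by blast
qed

end
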